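(* We have $\displaystyle\lim_{n\to\infty}\dim_HE(n)=1$, where for each integer $n\ge2$, $E(n)=\{x\in[0,1)\colon b_j(x)\le n\ \text{ for all }j\ge1\}$.
   Context: $\dim_H$ is Hausdorff dimension. Let $f(x)=\frac1{1-x}-\left\lfloor\frac1{1-x}\right\rfloor$ on $[0,1)$ (the Rényi map), and let $b_j(x)=\left\lfloor\frac1{1-f^{j-1}x}\right\rfloor+1\ge2$, $j\ge1$, be the digits of the backward continued fraction expansion $x=1-\cfrac1{b_1(x)-\cfrac1{b_2(x)-\ddots}}$. *)

theory Defs
  imports "HOL-Analysis.Analysis"
begin

(* The term of U in the s-dimensional Hausdorff sum, i.e. (diam U)^s with 0^0 = 1 for nonempty U
   and value 0 for empty U.  The case s = 0 is separate because 0 powr 0 = 0. *)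
definition hausdorff_gauge :: "real \<Rightarrow> 'a::metric_space set \<Rightarrow> ennreal" where
  "hausdorff_gauge s U =
     (if U = {} then 0 else if s = 0 then 1 else ennreal (diameter U powr s))"

(* Boundedness is required because diameter is unspecified on unbounded sets.
   Finite covers are included: the U i may be empty. *)
definition hausdorff_cover :: "real \<Rightarrow> 'a::metric_space set \<Rightarrow> (nat \<Rightarrow> 'a set) \<Rightarrow> bool" where
  "hausdorff_cover \<delta> A U \<longleftrightarrow>
     A \<subseteq> (\<Union>i. U i) \<and> (\<forall>i. bounded (U i) \<and> diameter (U i) \<le> \<delta>)"

definition hausdorff_content :: "real \<Rightarrow> real \<Rightarrow> 'a::metric_space set \<Rightarrow> ennreal" where
  "hausdorff_content s \<delta> A =
     (INF U\<in>{U. hausdorff_cover \<delta> A U}. (\<Sum>i. hausdorff_gauge s (U i)))"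

definition hausdorff_outer_measure :: "real \<Rightarrow> 'a::metric_space set \<Rightarrow> ennreal" where
  "hausdorff_outer_measure s A = (SUP \<delta>\<in>{0<..}. hausdorff_content s \<delta> A)"

(* Extended-valued: the infimum of the empty set is infinity. *)
definition hausdorff_dim :: "'a::metric_space set \<Rightarrow> ennreal" where
  "hausdorff_dim A = (INF s\<in>{s. 0 \<le> s \<and> hausdorff_outer_measure s A = 0}. ennreal s)"

(* Only meant for arguments in [0,1), which the map preserves. *)
definition renyi :: "real \<Rightarrow> real" where
  "renyi x = 1 / (1 - x) - real_of_int \<lfloor>1 / (1 - x)\<rfloor>"

(* Indexed from j = 1. *)
definition bcf_digit :: "nat \<Rightarrow> real \<Rightarrow> int" where
  "bcf_digit j x = \<lfloor>1 / (1 - (renyi ^^ (j - 1)) x)\<rfloor> + 1"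

definition bcf_bounded :: "nat \<Rightarrow> real set" where
  "bcf_bounded n = {x \<in> {0..<1}. \<forall>j\<ge>1. bcf_digit j x \<le> int n}"

end

theory Submission
  imports Defs
begin

text \<open>
  Since \<open>bcf_bounded n\<close> lies in the unit interval, only the lower bound needs an idea.  The backward
  expansion is awkward to handle directly: its map is neutral at the fixed point \<open>0\<close>, so its
  inverse branches do not contract uniformly.  Regular continued fractions do not have this defect, and
  the two expansions are related: a pair of regular partial quotients \<open>p, q\<close> corresponds to
  \<open>p - 1\<close> backward digits \<open>2\<close> followed by the backward digit \<open>q + 2\<close>.  Hence every number
  in \<open>(0,1)\<close> whose regular partial quotients are infinitely many and at most \<open>N\<close> belongs to
  \<open>bcf_bounded (N + 2)\<close> (\<open>bounded_type_subset_bcf_bounded\<close>), and it suffices to show, as Jarnik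
  did, that such numbers form sets of dimension arbitrarily close to \<open>1\<close>
  (\<open>bounded_type_set_hausdorff_dim_ge\<close>).
  
  For that, let \<open>s < 1\<close>.  Appending a partial quotient at most \<open>N\<close> to a word \<open>w\<close> splits the
  cylinder of \<open>w\<close> into pieces that fill all but at most a fraction \<open>2 / (N + 2)\<close> of it, and each piece is at
  most half as long.  The second fact gains a factor \<open>2 powr (1 - s)\<close> when lengths are replaced by
  their \<open>s\<close>-th powers, and for large \<open>N\<close> this gain beats the loss from the first.  So the sum of
  \<open>s\<close>-th powers of the lengths of the cylinders of order \<open>k\<close> grows exponentially in \<open>k\<close>.
  Continued fraction branches have distortion bounded independently of \<open>k\<close>, so for some \<open>k\<close> the
  branches of order \<open>k\<close> form an iterated function system whose lower contraction ratios \<open>r\<close>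
  satisfy \<open>(\<Sum>w. r w powr s) \<ge> 1\<close>.
  
  The invariant set of such a system has dimension at least \<open>s\<close> (\<open>ifs_hausdorff_dim_ge\<close>).
  In place of a mass distribution, the proof parametrizes a part of the invariant set by \<open>[0,1)\<close>: a
  number is sent to the point with the same address, where \<open>[0,1)\<close> is subdivided with ratios
  \<open>r w powr s\<close>.  The inverse of this parametrization is Hoelder with exponent \<open>s\<close>, so covers of the
  invariant set yield covers of \<open>[0,1)\<close>, whose Lebesgue measure bounds the Hausdorff sums from
  below (\<open>hausdorff_dim_ge_of_holder_inverse\<close>).
\<close>

section \<open>Hausdorff dimension\<close>

lemma hausdorff_dim_mono:
  assumes "A \<subseteq> B"
  shows "hausdorff_dim A \<le> hausdorff_dim B"
proof -
  have "hausdorff_content s \<delta> A \<le> hausdorff_content s \<delta> B" for s \<delta>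
    unfolding hausdorff_content_def hausdorff_cover_def
    using assms by (intro INF_superset_mono) auto
  then have le: "hausdorff_outer_measure s A \<le> hausdorff_outer_measure s B" for s
    unfolding hausdorff_outer_measure_def by (intro SUP_mono) auto
  have "hausdorff_outer_measure s A = 0" if "hausdorff_outer_measure s B = 0" for s
    using le[of s] that by simp
  then show ?thesis
    unfolding hausdorff_dim_def by (intro INF_superset_mono) auto
qed

text \<open>
  The cover by \<open>M\<close> intervals of length \<open>1 / M\<close> has Hausdorff sum \<open>M powr (1 - s)\<close>, which tends
  to \<open>0\<close>.
\<close>

lemma hausdorff_outer_measure_unit_interval_eq_0:
  assumes "1 < s"
  shows "hausdorff_outer_measure s {0..1::real} = 0"
proof -
  have "hausdorff_content s \<delta> {0..1::real} = 0" if "0 < \<delta>" for \<delta>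
  proof -
    have bound: "hausdorff_content s \<delta> {0..1::real} \<le> ennreal (real (Suc m) powr (1 - s))"
      if m: "1 / \<delta> \<le> real m" for m
    proof -
      define M where "M = Suc m"
      have M: "0 < M" "1 / \<delta> \<le> real M" using m by (auto simp: M_def)
      define U where "U = (\<lambda>i. if i < M then {real i / M .. (real i + 1) / M} else {})"
      have le: "real i / M \<le> (real i + 1) / M" for i by (intro divide_right_mono) auto
      have diam: "diameter (U i) = 1 / M" if "i < M" for i
        using that le[of i] by (simp add: U_def add_divide_distrib)
      have "{0..1} \<subseteq> (\<Union>i. U i)"
      proof
        fix x :: real assume x: "x \<in> {0..1}"
        show "x \<in> (\<Union>i. U i)"
        proof (cases "x = 1")
          case True
          then have "x \<in> U (M - 1)" using M by (simp add: U_def of_nat_diff)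
          then show ?thesis by blast
        next
          case False
          define i where "i = nat \<lfloor>x * M\<rfloor>"
          have i: "real i = of_int \<lfloor>x * M\<rfloor>" using x by (simp add: i_def)
          have "x * M < M" using x False M by simp
          then have "real i < M" unfolding i by linarith
          moreover have "real i \<le> x * M" "x * M \<le> real i + 1" unfolding i by linarith+
          ultimately have "x \<in> U i" using M by (simp add: U_def field_simps)
          then show ?thesis by blast
        qed
      qed
      moreover have "bounded (U i) \<and> diameter (U i) \<le> \<delta>" for i
      proof (cases "i < M")
        case True
        have "1 / M \<le> \<delta>" using M \<open>0 < \<delta>\<close> by (simp add: field_simps)
        then show ?thesis using diam[OF True] by (simp add: U_def)
      qed (use \<open>0 < \<delta>\<close> in \<open>simp add: U_def\<close>)
      ultimately have "hausdorff_cover \<delta> {0..1} U" by (simp add: hausdorff_cover_def)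
      then have "hausdorff_content s \<delta> {0..1::real} \<le> (\<Sum>i. hausdorff_gauge s (U i))"
        unfolding hausdorff_content_def by (intro INF_lower) simp
      also have "\<dots> = (\<Sum>i<M. hausdorff_gauge s (U i))"
        by (rule suminf_finite) (auto simp: U_def hausdorff_gauge_def)
      also have "\<dots> = (\<Sum>i<M. ennreal ((1 / M) powr s))"
      proof (rule sum.cong)
        fix i assume "i \<in> {..<M}"
        moreover have "U i \<noteq> {}" if "i < M" using that le by (simp add: U_def)
        ultimately show "hausdorff_gauge s (U i) = ennreal ((1 / M) powr s)"
          using diam assms by (simp add: hausdorff_gauge_def)
      qed simp
      also have "\<dots> = ennreal (real M * (1 / M) powr s)"
        by (simp add: ennreal_of_nat_eq_real_of_nat ennreal_mult)
      also have "real M * (1 / M) powr s = real M powr (1 - s)"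
        using M by (simp add: powr_diff powr_divide)
      finally show ?thesis by (simp add: M_def)
    qed
    have "(\<lambda>m. real (Suc m) powr (1 - s)) \<longlonglongrightarrow> 0"
      using assms by (intro tendsto_neg_powr filterlim_compose[OF filterlim_real_sequentially filterlim_Suc]) auto
    then have "(\<lambda>m. ennreal (real (Suc m) powr (1 - s))) \<longlonglongrightarrow> 0"
      using tendsto_ennrealI[of _ 0] by simp
    moreover have "\<forall>\<^sub>F m in sequentially. hausdorff_content s \<delta> {0..1::real} \<le> ennreal (real (Suc m) powr (1 - s))"
    proof -
      have "\<forall>\<^sub>F m in sequentially. 1 / \<delta> \<le> real m"
        using filterlim_real_sequentially by (simp add: filterlim_at_top)
      then show ?thesis by eventually_elim (rule bound)
    qed
    ultimately have "hausdorff_content s \<delta> {0..1::real} \<le> 0"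
      by (intro tendsto_lowerbound) auto
    then show ?thesis by simp
  qed
  then show ?thesis unfolding hausdorff_outer_measure_def by simp
qed

lemma hausdorff_dim_unit_interval_le: "hausdorff_dim {0..1::real} \<le> 1"
proof -
  have "hausdorff_dim {0..1::real} \<le> ennreal (1 + e)" if "0 < e" for e
    unfolding hausdorff_dim_def
    using that hausdorff_outer_measure_unit_interval_eq_0[of "1 + e"] by (intro INF_lower) auto
  then have "hausdorff_dim {0..1::real} \<le> 1 + ennreal e" if "0 < e" for e
    using that by simp
  then show ?thesis by (rule ennreal_le_epsilon)
qed

text \<open>
  Pulled back along \<open>c\<close>, a cover of \<open>A\<close> becomes a cover of \<open>[0,1)\<close>, and the hypothesis bounds the
  diameter of the pullback of \<open>U\<close> by \<open>C\<close> times the gauge of \<open>U\<close>.  As \<open>[0,1)\<close> has Lebesgue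
  measure \<open>1\<close>, Hausdorff sums stay away from \<open>0\<close>.
\<close>

lemma hausdorff_dim_ge_of_holder_inverse:
  fixes A :: "'a::metric_space set" and c :: "real \<Rightarrow> 'a"
  assumes cA: "\<And>t. t \<in> {0..<1} \<Longrightarrow> c t \<in> A" and s: "0 < s" and C: "0 < C"
    and hold: "\<And>t t'. t \<in> {0..<1} \<Longrightarrow> t' \<in> {0..<1} \<Longrightarrow> \<bar>t - t'\<bar> \<le> C * dist (c t) (c t') powr s"
  shows "ennreal s \<le> hausdorff_dim A"
proof (rule ccontr)
  assume "\<not> ennreal s \<le> hausdorff_dim A"
  then obtain s' where s': "0 \<le> s'" "s' < s" and zero: "hausdorff_outer_measure s' A = 0"
    unfolding hausdorff_dim_def by (auto simp: not_le INF_less_iff ennreal_less_iff)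
  \<comment> \<open>As distances in \<open>[0,1)\<close> are at most \<open>1\<close>, the Hoelder estimate passes to the smaller exponent \<open>s'\<close>.\<close>
  define B where "B = C powr (s' / s)"
  have B: "0 < B" using C by (simp add: B_def)
  have hold': "\<bar>t - t'\<bar> \<le> B * dist (c t) (c t') powr s'"
    if t: "t \<in> {0..<1}" "t' \<in> {0..<1}" for t t'
  proof (cases "t = t'")
    case False
    then have pos: "0 < \<bar>t - t'\<bar>" "\<bar>t - t'\<bar> \<le> 1" using t by auto
    have "\<bar>t - t'\<bar> = \<bar>t - t'\<bar> powr 1" using pos by simp
    also have "\<dots> \<le> \<bar>t - t'\<bar> powr (s' / s)"
      using pos s s' by (intro powr_mono') auto
    also have "\<dots> \<le> (C * dist (c t) (c t') powr s) powr (s' / s)"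
      using hold[OF t] s s' by (intro powr_mono2) auto
    also have "\<dots> = B * dist (c t) (c t') powr s'"
      using s C by (simp add: powr_mult B_def powr_powr)
    finally show ?thesis .
  qed simp
  have mass: "1 \<le> ennreal (2 * B) * (\<Sum>i. hausdorff_gauge s' (U i))" if U: "hausdorff_cover 1 A U" for U
  proof -
    have "\<exists>J. J \<in> sets lborel \<and> {t \<in> {0..<1}. c t \<in> U i} \<subseteq> J
        \<and> emeasure lborel J \<le> ennreal (2 * B) * hausdorff_gauge s' (U i)" for i
    proof (cases "\<exists>t0\<in>{0..<1}. c t0 \<in> U i")
      case True
      then obtain t0 where t0: "t0 \<in> {0..<1}" "c t0 \<in> U i" by blast
      define D where "D = diameter (U i) powr s'"
      have bd: "bounded (U i)" using U by (simp add: hausdorff_cover_def)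
      \<comment> \<open>For \<open>s' = 0\<close> and \<open>diameter (U i) = 0\<close> this says that the pullback is one point, as \<open>0 powr 0 = 0\<close>.\<close>
      have "\<bar>t - t0\<bar> \<le> B * D" if t: "t \<in> {0..<1}" "c t \<in> U i" for t
      proof -
        have "\<bar>t - t0\<bar> \<le> B * dist (c t) (c t0) powr s'" using hold'[OF t(1) t0(1)] .
        also have "\<dots> \<le> B * D" unfolding D_def
          using B s' bd t t0 by (intro mult_left_mono powr_mono2 diameter_bounded_bound) auto
        finally show ?thesis .
      qed
      then have "{t \<in> {0..<1}. c t \<in> U i} \<subseteq> {t0 - B * D .. t0 + B * D}"
        by (auto simp: abs_le_iff algebra_simps)
      moreover have "emeasure lborel {t0 - B * D .. t0 + B * D} = ennreal (2 * B) * ennreal D"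
        using B by (simp add: D_def ennreal_mult[symmetric] algebra_simps)
      moreover have "ennreal D \<le> hausdorff_gauge s' (U i)"
        using t0 by (auto simp: hausdorff_gauge_def D_def)
      ultimately show ?thesis
        by (intro exI[of _ "{t0 - B * D .. t0 + B * D}"]) (auto intro!: mult_left_mono)
    qed (auto intro!: exI[of _ "{}"])
    then obtain J where J: "\<And>i. J i \<in> sets lborel" "\<And>i. {t \<in> {0..<1}. c t \<in> U i} \<subseteq> J i"
      "\<And>i. emeasure lborel (J i) \<le> ennreal (2 * B) * hausdorff_gauge s' (U i)"
      by metis
    have "1 = emeasure lborel {0..<1::real}" by simp
    also have "\<dots> \<le> emeasure lborel (\<Union>i. J i)"
    proof (rule emeasure_mono)
      show "{0..<1} \<subseteq> (\<Union>i. J i)"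
        using U cA J(2) unfolding hausdorff_cover_def by blast
    qed (use J in auto)
    also have "\<dots> \<le> (\<Sum>i. emeasure lborel (J i))"
      using J by (intro emeasure_subadditive_countably) auto
    also have "\<dots> \<le> (\<Sum>i. ennreal (2 * B) * hausdorff_gauge s' (U i))"
      using J by (intro suminf_le) auto
    also have "\<dots> = ennreal (2 * B) * (\<Sum>i. hausdorff_gauge s' (U i))"
      by (rule ennreal_suminf_cmult)
    finally show ?thesis .
  qed
  have "hausdorff_content s' 1 A \<le> hausdorff_outer_measure s' A"
    unfolding hausdorff_outer_measure_def by (intro SUP_upper) simp
  then have "hausdorff_content s' 1 A < ennreal (1 / (2 * B))" using zero B by simp
  then obtain U where U: "hausdorff_cover 1 A U"
    and lt: "(\<Sum>i. hausdorff_gauge s' (U i)) < ennreal (1 / (2 * B))"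
    unfolding hausdorff_content_def by (auto simp: INF_less_iff)
  have "1 \<le> ennreal (2 * B) * (\<Sum>i. hausdorff_gauge s' (U i))" by (rule mass[OF U])
  also have "\<dots> < ennreal (2 * B) * ennreal (1 / (2 * B))"
    using lt B by (intro ennreal_mult_strict_left_mono) auto
  also have "\<dots> = 1" using B by (simp add: ennreal_mult[symmetric])
  finally show False by simp
qed

section \<open>Iterated function systems\<close>

lemma intervals_of_given_lengths_cover:
  fixes p :: "'i \<Rightarrow> real"
  assumes "finite I"
  shows "\<exists>l. \<forall>t. 0 \<le> t \<longrightarrow> t < sum p I \<longrightarrow> (\<exists>i\<in>I. l i \<le> t \<and> t < l i + p i)"
  using assms
proof (induction I)
  case (insert i I)
  then obtain l where l: "\<And>t. 0 \<le> t \<Longrightarrow> t < sum p I \<Longrightarrow> \<exists>j\<in>I. l j \<le> t \<and> t < l j + p j"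
    by blast
  have "\<exists>j\<in>insert i I. (l(i := sum p I)) j \<le> t \<and> t < (l(i := sum p I)) j + p j"
    if t: "0 \<le> t" "t < sum p (insert i I)" for t
  proof (cases "t < sum p I")
    case True
    then show ?thesis using l[OF t(1)] insert.hyps by (metis fun_upd_other insertI2)
  next
    case False
    then show ?thesis using t insert.hyps by auto
  qed
  then show ?case by blast
qed simp

text \<open>
  The intervals of lengths \<open>p i\<close> give every \<open>t\<close> a first digit \<open>d t\<close>; the map \<open>F\<close> rescales the
  interval of that digit affinely, so that the digits of \<open>F t\<close>, \<open>F (F t)\<close>, ... continue the address
  of \<open>t\<close>.  If the weights sum to more than \<open>1\<close>, the intervals reach beyond \<open>[0,1)\<close>, and some
  addresses do not occur.
\<close>

lemma expanding_coding_exists: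
  fixes p :: "'i \<Rightarrow> real"
  assumes fin: "finite I" and pos: "\<And>i. i \<in> I \<Longrightarrow> 0 < p i" and sum: "1 \<le> sum p I"
  shows "\<exists>d F. (\<forall>t\<in>{0..<1::real}. d t \<in> I \<and> F t \<in> {0..<1::real})
    \<and> (\<forall>t\<in>{0..<1}. \<forall>t'\<in>{0..<1}. d t = d t' \<longrightarrow> t - t' = p (d t) * (F t - F t'))"
proof -
  obtain l where l: "\<And>t. 0 \<le> t \<Longrightarrow> t < sum p I \<Longrightarrow> \<exists>i\<in>I. l i \<le> t \<and> t < l i + p i"
    using intervals_of_given_lengths_cover[OF fin] by metis
  have "\<exists>i\<in>I. l i \<le> t \<and> t < l i + p i" if "t \<in> {0..<1}" for t
    using l[of t] that sum by auto
  then obtain d where d: "\<And>t. t \<in> {0..<1} \<Longrightarrow> d t \<in> I \<and> l (d t) \<le> t \<and> t < l (d t) + p (d t)"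
    by metis
  define F where "F t = (t - l (d t)) / p (d t)" for t
  have "d t \<in> I \<and> F t \<in> {0..<1}" if "t \<in> {0..<1}" for t
    using d[OF that] pos[of "d t"] by (auto simp: F_def)
  moreover have "t - t' = p (d t) * (F t - F t')"
    if "t \<in> {0..<1}" "t' \<in> {0..<1}" "d t = d t'" for t t'
    using d[OF that(1)] pos[of "d t"] that(3) by (simp add: F_def field_simps)
  ultimately show ?thesis by blast
qed

text \<open>
  The images of \<open>K\<close> under the compositions \<open>P m\<close> of the first \<open>m\<close> maps are nested and compact, hence
  have a common point \<open>x 0\<close>.  Its preimages under the \<open>P m\<close> are the other points: injectivity makes
  consecutive ones fit together.
\<close>

lemma ifs_point_with_address:
  fixes \<Phi> :: "'i \<Rightarrow> 'a::heine_borel \<Rightarrow> 'a"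
  assumes K: "compact K" "K \<noteq> {}"
    and maps: "\<And>i x. i \<in> I \<Longrightarrow> x \<in> K \<Longrightarrow> \<Phi> i x \<in> K"
    and cont: "\<And>i. i \<in> I \<Longrightarrow> continuous_on K (\<Phi> i)"
    and inj: "\<And>i. i \<in> I \<Longrightarrow> inj_on (\<Phi> i) K"
    and \<omega>: "\<And>j. \<omega> j \<in> I"
  shows "\<exists>x. \<forall>j::nat. x j \<in> K \<and> x j = \<Phi> (\<omega> j) (x (Suc j))"
proof -
  define P where "P m = fold (\<lambda>j f. f \<circ> \<Phi> (\<omega> j)) [0..<m] id" for m
  have P0: "P 0 = id" and PS: "P (Suc m) = P m \<circ> \<Phi> (\<omega> m)" for m
    by (simp_all add: P_def)
  have cinj: "continuous_on K (P m) \<and> inj_on (P m) K \<and> P m ` K \<subseteq> K" for m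
  proof (induction m)
    case 0
    then show ?case by (simp add: P0)
  next
    case (Suc m)
    have sub: "\<Phi> (\<omega> m) ` K \<subseteq> K" using maps \<omega> by blast
    have "continuous_on K (P (Suc m))" unfolding PS
      using Suc cont[OF \<omega>] sub by (intro continuous_on_compose) (auto intro: continuous_on_subset)
    moreover have "inj_on (P (Suc m)) K" unfolding PS
      using Suc inj[OF \<omega>] sub by (intro comp_inj_on) (auto intro: inj_on_subset)
    moreover have "P (Suc m) ` K \<subseteq> K" using Suc sub by (auto simp: PS)
    ultimately show ?case by blast
  qed
  have dec: "P n ` K \<subseteq> P m ` K" if "m \<le> n" for m n
    using that
  proof (induction n rule: dec_induct)
    case (step n)
    have "P (Suc n) ` K \<subseteq> P n ` K" using maps \<omega> by (auto simp: PS)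
    then show ?case using step by blast
  qed simp
  have "(\<Inter>m. P m ` K) \<noteq> {}"
    using K cinj dec by (intro compact_nest compact_continuous_image)  auto
  then obtain y where "\<forall>m. y \<in> P m ` K" by blast
  then have "\<forall>m. \<exists>z. z \<in> K \<and> y = P m z" by blast
  then obtain x where x: "\<And>m. x m \<in> K" "\<And>m. y = P m (x m)" by (auto simp: choice_iff)
  have "x m = \<Phi> (\<omega> m) (x (Suc m))" for m
  proof (rule inj_onD)
    show "inj_on (P m) K" using cinj by blast
    show "P m (x m) = P m (\<Phi> (\<omega> m) (x (Suc m)))" using x(2)[of m] x(2)[of "Suc m"] by (simp add: PS)
  qed (use x maps \<omega> in auto)
  then show ?thesis using x by blast
qed

lemma finite_disjoint_compact_separated:
  fixes S :: "'i \<Rightarrow> 'a::heine_borel set"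
  assumes "finite I" and comp: "\<And>i. i \<in> I \<Longrightarrow> compact (S i)"
    and disj: "\<And>i j. i \<in> I \<Longrightarrow> j \<in> I \<Longrightarrow> i \<noteq> j \<Longrightarrow> S i \<inter> S j = {}"
  shows "\<exists>\<delta>>0. \<forall>i\<in>I. \<forall>j\<in>I. i \<noteq> j \<longrightarrow> (\<forall>x\<in>S i. \<forall>y\<in>S j. \<delta> \<le> dist x y)"
proof -
  define R where "R = {z \<in> I \<times> I. fst z \<noteq> snd z}"
  have "finite R" using assms(1) by (simp add: R_def)
  have "\<exists>d>0. \<forall>x\<in>S (fst z). \<forall>y\<in>S (snd z). d \<le> dist x y" if "z \<in> R" for z
    using that comp disj[of "fst z" "snd z"]
    by (intro separate_compact_closed) (auto simp: R_def intro: compact_imp_closed)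
  then obtain d where d: "\<And>z. z \<in> R \<Longrightarrow> 0 < d z \<and> (\<forall>x\<in>S (fst z). \<forall>y\<in>S (snd z). d z \<le> dist x y)"
    by metis
  define \<delta> where "\<delta> = Min (insert 1 (d ` R))"
  have "0 < \<delta>" using \<open>finite R\<close> d by (simp add: \<delta>_def)
  moreover have "\<delta> \<le> dist x y" if "i \<in> I" "j \<in> I" "i \<noteq> j" "x \<in> S i" "y \<in> S j" for i j x y
  proof -
    have R: "(i, j) \<in> R" using that by (simp add: R_def)
    then have "\<delta> \<le> d (i, j)" using \<open>finite R\<close> by (simp add: \<delta>_def)
    also have "\<dots> \<le> dist x y" using d[OF R] that by simp
    finally show ?thesis .
  qed
  ultimately show ?thesis by blast
qed

text \<open>
  Let \<open>[0,1)\<close> be coded with weights \<open>r i powr s\<close>.  If the addresses of \<open>t\<close> and \<open>t'\<close> first differ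
  at place \<open>m\<close>, and \<open>R m\<close> is the product of the ratios before it, then \<open>t\<close> and \<open>t'\<close> are at
  distance at most \<open>R m powr s\<close>, whereas the corresponding points are at distance at least
  \<open>R m * \<delta>\<close>, where \<open>\<delta>\<close> separates the images of \<open>K\<close>.  This is the Hoelder estimate for the
  inverse parametrization.
\<close>

lemma ifs_hausdorff_dim_ge:
  fixes \<Phi> :: "'i \<Rightarrow> 'a::heine_borel \<Rightarrow> 'a" and r :: "'i \<Rightarrow> real"
  assumes fin: "finite I" and K: "compact K" "K \<noteq> {}"
    and maps: "\<And>i x. i \<in> I \<Longrightarrow> x \<in> K \<Longrightarrow> \<Phi> i x \<in> K"
    and cont: "\<And>i. i \<in> I \<Longrightarrow> continuous_on K (\<Phi> i)"
    and disj: "\<And>i j. i \<in> I \<Longrightarrow> j \<in> I \<Longrightarrow> i \<noteq> j \<Longrightarrow> \<Phi> i ` K \<inter> \<Phi> j ` K = {}"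
    and r: "\<And>i. i \<in> I \<Longrightarrow> 0 < r i \<and> r i < 1"
    and expand: "\<And>i x y. i \<in> I \<Longrightarrow> x \<in> K \<Longrightarrow> y \<in> K \<Longrightarrow> r i * dist x y \<le> dist (\<Phi> i x) (\<Phi> i y)"
    and s: "0 < s" and sum: "1 \<le> (\<Sum>i\<in>I. r i powr s)"
  shows "\<exists>A\<subseteq>K. (\<forall>x\<in>A. \<exists>i\<in>I. \<exists>y\<in>A. x = \<Phi> i y) \<and> ennreal s \<le> hausdorff_dim A"
proof -
  define p where "p i = r i powr s" for i
  have p: "0 < p i \<and> p i < 1" if "i \<in> I" for i
    using r[OF that] s powr_less_mono2[of s "r i" 1] by (simp add: p_def)
  have p_pos: "0 < p i" if "i \<in> I" for i using p[OF that] by blast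
  have p_sum: "1 \<le> sum p I" using sum by (simp add: p_def)
  have inj: "inj_on (\<Phi> i) K" if "i \<in> I" for i
  proof (rule inj_onI)
    fix x y assume "x \<in> K" "y \<in> K" "\<Phi> i x = \<Phi> i y"
    then have "r i * dist x y \<le> 0" using expand[OF that, of x y] by simp
    then show "x = y" using r[OF that] by (simp add: mult_le_0_iff)
  qed
  obtain d F where d: "\<And>t. t \<in> {0..<1::real} \<Longrightarrow> d t \<in> I"
    and F: "\<And>t. t \<in> {0..<1} \<Longrightarrow> F t \<in> {0..<1::real}"
    and dF: "\<And>t t'. t \<in> {0..<1} \<Longrightarrow> t' \<in> {0..<1} \<Longrightarrow> d t = d t' \<Longrightarrow> t - t' = p (d t) * (F t - F t')"
    using expanding_coding_exists[OF fin p_pos p_sum] by blast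
  define \<omega> where "\<omega> t j = d ((F ^^ j) t)" for t j
  have Fj: "(F ^^ j) t \<in> {0..<1}" if "t \<in> {0..<1}" for t j
    using that by (induction j) (simp_all add: F del: atLeastLessThan_iff)
  have \<omega>: "\<omega> t j \<in> I" if "t \<in> {0..<1}" for t j
    unfolding \<omega>_def using d Fj that by blast
  have "\<exists>x. \<forall>j. x j \<in> K \<and> x j = \<Phi> (\<omega> t j) (x (Suc j))" if "t \<in> {0..<1}" for t
    using that by (intro ifs_point_with_address[OF K maps cont inj]) (auto simp: \<omega>)
  then obtain x where xK: "\<And>t j. t \<in> {0..<1} \<Longrightarrow> x t j \<in> K"
    and x: "\<And>t j. t \<in> {0..<1} \<Longrightarrow> x t j = \<Phi> (\<omega> t j) (x t (Suc j))" by metis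
  have "\<exists>\<delta>>0. \<forall>i\<in>I. \<forall>j\<in>I. i \<noteq> j \<longrightarrow> (\<forall>x\<in>\<Phi> i ` K. \<forall>y\<in>\<Phi> j ` K. \<delta> \<le> dist x y)"
    using fin compact_continuous_image[OF cont K(1)] disj by (rule finite_disjoint_compact_separated)
  then obtain \<delta> where \<delta>: "0 < \<delta>" and sep: "\<forall>i\<in>I. \<forall>j\<in>I. i \<noteq> j \<longrightarrow> (\<forall>x\<in>\<Phi> i ` K. \<forall>y\<in>\<Phi> j ` K. \<delta> \<le> dist x y)"
    by (elim exE conjE)
  define A where "A = {x t j |t j. t \<in> {0..<1}}"
  show ?thesis
  proof (intro exI[of _ A] conjI ballI)
    show "A \<subseteq> K" using xK by (auto simp: A_def)
    show "\<exists>i\<in>I. \<exists>y\<in>A. z = \<Phi> i y" if z: "z \<in> A" for z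
    proof -
      obtain t j where tj: "t \<in> {0..<1}" "z = x t j" using z by (auto simp: A_def)
      have "x t (Suc j) \<in> A" using tj by (auto simp: A_def)
      then show ?thesis using x[OF tj(1), of j] \<omega>[OF tj(1), of j] tj(2) by blast
    qed
    show "ennreal s \<le> hausdorff_dim A"
    proof (rule hausdorff_dim_ge_of_holder_inverse[of "\<lambda>t. x t 0" A s "(1 / \<delta>) powr s"])
      show "x t 0 \<in> A" if "t \<in> {0..<1}" for t using that by (auto simp: A_def)
      show "0 < (1 / \<delta>) powr s" using \<delta> by simp
      fix t t' :: real assume t: "t \<in> {0..<1}" and t': "t' \<in> {0..<1}"
      show "\<bar>t - t'\<bar> \<le> (1 / \<delta>) powr s * dist (x t 0) (x t' 0) powr s"
      proof (cases "t = t'")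
        case False
        define R where "R m = (\<Prod>j<m. r (\<omega> t j))" for m
        have Rpos: "0 < R m" for m unfolding R_def using r \<omega>[OF t] by (intro prod_pos) auto
        have agree: "t - t' = R m powr s * ((F ^^ m) t - (F ^^ m) t')
            \<and> R m * dist (x t m) (x t' m) \<le> dist (x t 0) (x t' 0)"
          if "\<forall>j<m. \<omega> t j = \<omega> t' j" for m
          using that
        proof (induction m)
          case (Suc m)
          have eq: "\<omega> t m = \<omega> t' m" using Suc.prems by simp
          have IH: "t - t' = R m powr s * ((F ^^ m) t - (F ^^ m) t')"
            "R m * dist (x t m) (x t' m) \<le> dist (x t 0) (x t' 0)" using Suc by auto
          have RS: "R (Suc m) = R m * r (\<omega> t m)" by (simp add: R_def)
          have "(F ^^ m) t - (F ^^ m) t' = p (\<omega> t m) * ((F ^^ Suc m) t - (F ^^ Suc m) t')"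
            using dF[OF Fj[OF t] Fj[OF t'], of m m] eq by (simp add: \<omega>_def)
          then have 1: "t - t' = R (Suc m) powr s * ((F ^^ Suc m) t - (F ^^ Suc m) t')"
            unfolding IH(1) RS p_def using Rpos[of m] r[OF \<omega>[OF t, of m]] by (simp add: powr_mult)
          have "R (Suc m) * dist (x t (Suc m)) (x t' (Suc m)) \<le> R m * dist (x t m) (x t' m)"
            using expand[OF \<omega>[OF t, of m] xK[OF t, of "Suc m"] xK[OF t', of "Suc m"]] Rpos[of m]
            unfolding RS mult.assoc x[OF t, of m] x[OF t', of m] eq by (intro mult_left_mono) auto
          then show ?case using 1 IH(2) by linarith
        qed (simp add: R_def)
        \<comment> \<open>The weights are bounded by some \<open>q < 1\<close>, so numbers with equal addresses are equal.\<close>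
        have "\<exists>j. \<omega> t j \<noteq> \<omega> t' j"
        proof (rule ccontr)
          assume "\<not> ?thesis"
          then have all: "\<And>j. \<omega> t j = \<omega> t' j" by blast
          have "I \<noteq> {}" using \<omega>[OF t] by blast
          define q where "q = Max (p ` I)"
          have q: "0 \<le> q" "q < 1" "\<And>i. i \<in> I \<Longrightarrow> p i \<le> q"
            using \<open>I \<noteq> {}\<close> fin p by (auto simp: q_def Max_ge_iff intro: less_imp_le)
          have "\<bar>t - t'\<bar> \<le> q ^ m" for m
          proof -
            have "R m powr s = (\<Prod>j<m. p (\<omega> t j))"
              unfolding R_def p_def using r \<omega>[OF t] by (auto intro: prod_powr_distrib less_imp_le)
            also have "\<dots> \<le> (\<Prod>j<m. q)"
              using q p \<omega>[OF t] by (intro prod_mono) (auto intro: less_imp_le)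
            finally have "R m powr s \<le> q ^ m" by simp
            moreover have "\<bar>(F ^^ m) t - (F ^^ m) t'\<bar> \<le> 1" using Fj[OF t, of m] Fj[OF t', of m] by auto
            moreover have "\<bar>t - t'\<bar> = R m powr s * \<bar>(F ^^ m) t - (F ^^ m) t'\<bar>"
              using agree[of m] all by (metis abs_mult abs_of_nonneg powr_ge_zero)
            ultimately show ?thesis
              using mult_mono[of "R m powr s" "q ^ m" "\<bar>(F ^^ m) t - (F ^^ m) t'\<bar>" 1] q by simp
          qed
          moreover have "(\<lambda>m. q ^ m) \<longlonglongrightarrow> 0" using q by (intro LIMSEQ_realpow_zero) auto
          ultimately have "\<bar>t - t'\<bar> \<le> 0" by (intro LIMSEQ_le_const) auto
          then show False using False by simp
        qed
        then obtain m where m: "\<omega> t m \<noteq> \<omega> t' m" "\<forall>j<m. \<omega> t j = \<omega> t' j"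
          using exists_least_iff[of "\<lambda>j. \<omega> t j \<noteq> \<omega> t' j"] by blast
        have "x t m \<in> \<Phi> (\<omega> t m) ` K" "x t' m \<in> \<Phi> (\<omega> t' m) ` K"
          using x[OF t, of m] xK[OF t, of "Suc m"] x[OF t', of m] xK[OF t', of "Suc m"] by (metis imageI)+
        then have "\<delta> \<le> dist (x t m) (x t' m)" using sep \<omega>[OF t] \<omega>[OF t'] m(1) by blast
        then have "R m * \<delta> \<le> R m * dist (x t m) (x t' m)" using Rpos[of m] by (intro mult_left_mono) auto
        also have "\<dots> \<le> dist (x t 0) (x t' 0)" using agree[OF m(2)] by blast
        finally have Rle: "R m \<le> 1 / \<delta> * dist (x t 0) (x t' 0)" using \<delta> by (simp add: field_simps)
        have "\<bar>t - t'\<bar> = R m powr s * \<bar>(F ^^ m) t - (F ^^ m) t'\<bar>"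
          using agree[OF m(2)] by (metis abs_mult abs_of_nonneg powr_ge_zero)
        also have "\<dots> \<le> R m powr s"
          using Fj[OF t, of m] Fj[OF t', of m] by (intro mult_left_le) auto
        also have "\<dots> \<le> (1 / \<delta> * dist (x t 0) (x t' 0)) powr s"
          using Rle Rpos[of m] s by (intro powr_mono2) auto
        also have "\<dots> = (1 / \<delta>) powr s * dist (x t 0) (x t' 0) powr s"
          by (rule powr_mult)
        finally show ?thesis .
      qed simp
    qed (rule s)
  qed
qed

section \<open>Regular continued fractions\<close>

definition gauss_branch :: "nat \<Rightarrow> real \<Rightarrow> real" where
  "gauss_branch a y = 1 / (real a + y)"

text \<open>
  A word acts by \<open>fold\<close>, so its first letter is applied first and is the innermost partial quotient.
  With \<open>w\<close> read from its end, \<open>denom w\<close> is the denominator of the last convergent and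
  \<open>denom' w\<close> that of the last but one: prepending a letter refines the cylinder.
\<close>

fun denom denom' :: "nat list \<Rightarrow> real" where
  "denom [] = 1"
| "denom (a # w) = real a * denom w + denom' w"
| "denom' [] = 0"
| "denom' (a # w) = denom w"

text \<open>
  This is the length of the image of \<open>[0,1]\<close> under the word \<open>w\<close>.
\<close>

definition cylinder_length :: "nat list \<Rightarrow> real" where
  "cylinder_length w = 1 / (denom w * (denom w + denom' w))"

definition words :: "nat \<Rightarrow> nat \<Rightarrow> nat list set" where
  "words N k = {w. set w \<subseteq> {1..N} \<and> length w = k}"

lemma denom_bounds:
  assumes "0 \<notin> set w"
  shows "1 \<le> denom w" "0 \<le> denom' w" "denom' w \<le> denom w"
proof -
  have "1 \<le> denom w \<and> 0 \<le> denom' w \<and> denom' w \<le> denom w" using assms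
  proof (induction w)
    case (Cons a w)
    then have "1 * denom w \<le> real a * denom w" by (intro mult_right_mono) auto
    moreover have "1 \<le> denom w" "0 \<le> denom' w" using Cons by auto
    ultimately show ?case unfolding denom.simps denom'.simps by (intro conjI; linarith)
  qed simp
  then show "1 \<le> denom w" "0 \<le> denom' w" "denom' w \<le> denom w" by auto
qed

lemma word_map_in_unit_interval:
  assumes "0 \<notin> set w" "0 < x" "x < 1"
  shows "0 < fold gauss_branch w x \<and> fold gauss_branch w x < 1"
  using assms
proof (induction w arbitrary: x)
  case (Cons a w)
  then have "0 < gauss_branch a x \<and> gauss_branch a x < 1" by (simp add: gauss_branch_def field_simps)
  then show ?case using Cons by simp
qed simp

text \<open>
  The word acts as a fractional linear map of determinant \<open>\<plusminus>1\<close> whose denominator is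
  \<open>denom w + denom' w * x\<close>.
\<close>

lemma word_map_dist:
  assumes "0 \<notin> set w" "0 \<le> x" "0 \<le> y"
  shows "\<bar>fold gauss_branch w x - fold gauss_branch w y\<bar> =
    \<bar>x - y\<bar> / ((denom w + denom' w * x) * (denom w + denom' w * y))"
  using assms
proof (induction w arbitrary: x y)
  case (Cons a w)
  have a: "0 < real a + x" "0 < real a + y" using Cons.prems by auto
  have gb: "0 \<le> gauss_branch a x" "0 \<le> gauss_branch a y" using a by (simp_all add: gauss_branch_def)
  have den: "(denom w + denom' w * gauss_branch a z) * (real a + z) = denom (a # w) + denom' (a # w) * z"
    if "0 < real a + z" for z
    using that by (simp add: gauss_branch_def field_simps)
  have "gauss_branch a x - gauss_branch a y = (y - x) / ((real a + x) * (real a + y))"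
    using a by (simp add: gauss_branch_def field_simps)
  then have br: "\<bar>gauss_branch a x - gauss_branch a y\<bar> = \<bar>x - y\<bar> / ((real a + x) * (real a + y))"
    using a by (simp add: abs_mult abs_minus_commute)
  have "\<bar>fold gauss_branch (a # w) x - fold gauss_branch (a # w) y\<bar>
      = \<bar>gauss_branch a x - gauss_branch a y\<bar>
        / ((denom w + denom' w * gauss_branch a x) * (denom w + denom' w * gauss_branch a y))"
    using Cons.IH[of "gauss_branch a x" "gauss_branch a y"] Cons.prems gb by simp
  also have "\<dots> = \<bar>x - y\<bar> / (((denom w + denom' w * gauss_branch a x) * (real a + x))
      * ((denom w + denom' w * gauss_branch a y) * (real a + y)))"
    unfolding br by (simp add: mult_ac)
  also have "\<dots> = \<bar>x - y\<bar> / ((denom (a # w) + denom' (a # w) * x) * (denom (a # w) + denom' (a # w) * y))"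
    by (simp only: den[OF a(1)] den[OF a(2)])
  finally show ?case .
qed simp

lemma word_map_inj:
  assumes "length w = length v" "0 \<notin> set w" "0 \<notin> set v" "0 < x" "x < 1" "0 < y" "y < 1"
    and "fold gauss_branch w x = fold gauss_branch v y"
  shows "w = v"
  using assms
proof (induction w arbitrary: v rule: rev_induct)
  case (snoc a w)
  then obtain v' b where v: "v = v' @ [b]" by (cases v rule: rev_cases) auto
  define X where "X = fold gauss_branch w x"
  define Y where "Y = fold gauss_branch v' y"
  have XY: "0 < X" "X < 1" "0 < Y" "Y < 1"
    using word_map_in_unit_interval[of w x] word_map_in_unit_interval[of v' y] snoc.prems
    by (auto simp: X_def Y_def v)
  have "gauss_branch a X = gauss_branch b Y"
    using snoc.prems by (simp add: v X_def Y_def)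
  then have eq: "real a + X = real b + Y" by (simp add: gauss_branch_def)
  then have "a = b" using XY by linarith
  moreover from this eq have "X = Y" by simp
  then have "w = v'" using snoc by (auto simp: v X_def Y_def)
  ultimately show ?case by (simp add: v)
qed simp

lemma cylinder_length_pos: "0 \<notin> set w \<Longrightarrow> 0 < cylinder_length w"
  using denom_bounds[of w] by (simp add: cylinder_length_def)

text \<open>
  Together with the next lemma, this is bounded distortion: no distance is multiplied by less than
  half the length of the cylinder, however long the word is.
\<close>

lemma word_map_dist_ge:
  assumes w: "0 \<notin> set w" and xy: "0 \<le> x" "x \<le> 1" "0 \<le> y" "y \<le> 1"
  shows "\<bar>x - y\<bar> / (denom w + denom' w)\<^sup>2 \<le> \<bar>fold gauss_branch w x - fold gauss_branch w y\<bar>"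
proof -
  note b = denom_bounds[OF w]
  have le: "0 < denom w + denom' w * z" "denom w + denom' w * z \<le> denom w + denom' w"
    if z: "0 \<le> z" "z \<le> 1" for z
    using b mult_left_le[OF z(2) b(2)] mult_nonneg_nonneg[OF b(2) z(1)] by linarith+
  have "(denom w + denom' w * x) * (denom w + denom' w * y) \<le> (denom w + denom' w)\<^sup>2"
    unfolding power2_eq_square
    using le[OF xy(1,2)] le[OF xy(3,4)] b by (intro mult_mono) auto
  moreover have "0 < (denom w + denom' w * x) * (denom w + denom' w * y)"
    using le[OF xy(1,2)] le[OF xy(3,4)] by simp
  ultimately show ?thesis
    unfolding word_map_dist[OF w xy(1,3)] by (intro frac_le) auto
qed

lemma cylinder_length_le:
  assumes "0 \<notin> set w"
  shows "cylinder_length w \<le> 2 / (denom w + denom' w)\<^sup>2"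
proof -
  note b = denom_bounds[OF assms]
  have "(denom w + denom' w) * (denom w + denom' w) \<le> (2 * denom w) * (denom w + denom' w)"
    using b by (intro mult_right_mono) auto
  then show ?thesis
    using b by (simp add: cylinder_length_def power2_eq_square divide_le_eq le_divide_eq mult_ac)
qed

lemma cylinder_length_Cons_le:
  assumes "0 \<notin> set w" "1 \<le> a"
  shows "cylinder_length (a # w) \<le> cylinder_length w / 2"
proof -
  define Q Q' where "Q = denom w" and "Q' = denom' w"
  have Q: "1 \<le> Q" "0 \<le> Q'" using denom_bounds[OF assms(1)] by (auto simp: Q_def Q'_def)
  have aQ: "1 * Q \<le> real a * Q" using assms Q by (intro mult_right_mono) auto
  have "Q + Q' \<le> real a * Q + Q'" "2 * Q \<le> real a * Q + Q' + Q" using aQ Q by linarith+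
  then have "(Q + Q') * (2 * Q) \<le> (real a * Q + Q') * (real a * Q + Q' + Q)"
    using Q by (intro mult_mono) auto
  moreover from this have "0 < (real a * Q + Q') * (real a * Q + Q' + Q) * ((Q + Q') * (2 * Q))"
    using Q by (intro mult_pos_pos[OF less_le_trans]) auto
  ultimately have "1 / ((real a * Q + Q') * (real a * Q + Q' + Q)) \<le> 1 / ((Q + Q') * (2 * Q))"
    by (rule divide_left_mono[OF _ zero_le_one])
  then show ?thesis by (simp add: cylinder_length_def Q_def Q'_def mult_ac)
qed

text \<open>
  Partial fractions make the sum telescope.  The part of the cylinder that is left over belongs to
  the letters beyond \<open>N\<close>, and is a fraction \<open>(Q + Q') / ((N + 1) * Q + Q')\<close> of it.
\<close>

lemma sum_cylinder_length_Cons_ge: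
  assumes "0 \<notin> set w"
  shows "(1 - 2 / (real N + 2)) * cylinder_length w \<le> (\<Sum>a=1..N. cylinder_length (a # w))"
proof -
  define Q Q' where "Q = denom w" and "Q' = denom' w"
  have Q: "1 \<le> Q" "0 \<le> Q'" "Q' \<le> Q" using denom_bounds[OF assms(1)] by (auto simp: Q_def Q'_def)
  have pos: "0 < real a * Q + Q'" if "1 \<le> a" for a :: nat
    using that Q by (intro add_pos_nonneg mult_pos_pos) auto
  have "cylinder_length (a # w) = (1 / (real a * Q + Q') - 1 / (real (Suc a) * Q + Q')) / Q"
    if "1 \<le> a" for a
  proof -
    have ne: "real a * Q + Q' \<noteq> 0" "real (Suc a) * Q + Q' \<noteq> 0" "Q \<noteq> 0"
      using pos[OF that] pos[of "Suc a"] Q by auto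
    have "1 / (real a * Q + Q') - 1 / (real (Suc a) * Q + Q')
        = Q / ((real a * Q + Q') * (real (Suc a) * Q + Q'))"
      using ne by (simp add: diff_frac_eq) (simp add: algebra_simps)
    moreover have "cylinder_length (a # w) = 1 / ((real a * Q + Q') * (real (Suc a) * Q + Q'))"
      by (simp add: cylinder_length_def Q_def Q'_def algebra_simps)
    ultimately show ?thesis using ne(3) by simp
  qed
  then have "(\<Sum>a=1..N. cylinder_length (a # w))
      = (\<Sum>a=1..N. 1 / (real a * Q + Q') - 1 / (real (Suc a) * Q + Q')) / Q"
    unfolding sum_divide_distrib by (intro sum.cong) auto
  also have "(\<Sum>a=1..N. 1 / (real a * Q + Q') - 1 / (real (Suc a) * Q + Q'))
      = 1 / (Q + Q') - 1 / (real (Suc N) * Q + Q')"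
    by (induction N) auto
  also have "\<dots> = (1 - (Q + Q') / (real (Suc N) * Q + Q')) / (Q + Q')"
    using Q by (simp add: diff_divide_distrib)
  finally have eq: "(\<Sum>a=1..N. cylinder_length (a # w))
      = (1 - (Q + Q') / (real (Suc N) * Q + Q')) * cylinder_length w"
    by (simp add: cylinder_length_def Q_def Q'_def mult_ac)
  have "real N * Q' \<le> real N * Q" using Q by (intro mult_left_mono) auto
  then have "(Q + Q') * (real N + 2) \<le> 2 * (real (Suc N) * Q + Q')" by (simp add: algebra_simps)
  then have "(Q + Q') / (real (Suc N) * Q + Q') \<le> 2 / (real N + 2)"
    using pos[of "Suc N"] by (simp add: divide_le_eq le_divide_eq)
  then show ?thesis unfolding eq using cylinder_length_pos[OF assms]
    by (intro mult_right_mono) auto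
qed

text \<open>
  Write the \<open>s\<close>-th power of a length as the length times its power with the negative exponent
  \<open>s - 1\<close>.  That power is smallest for the longest piece, of at most half the length of the cylinder.
\<close>

lemma sum_cylinder_length_Cons_powr_ge:
  assumes w: "0 \<notin> set w" and s: "s < 1"
  shows "2 powr (1 - s) * (1 - 2 / (real N + 2)) * cylinder_length w powr s
    \<le> (\<Sum>a=1..N. cylinder_length (a # w) powr s)"
proof -
  define L where "L = cylinder_length w"
  have L: "0 < L" using cylinder_length_pos[OF w] by (simp add: L_def)
  have "2 powr (1 - s) * L powr s = L * (L / 2) powr (s - 1)"
    using L by (simp add: powr_divide powr_diff powr_add field_simps)
  then have "2 powr (1 - s) * (1 - 2 / (real N + 2)) * L powr s
      = (1 - 2 / (real N + 2)) * L * (L / 2) powr (s - 1)"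
    by (simp add: mult_ac)
  also have "\<dots> \<le> (\<Sum>a=1..N. cylinder_length (a # w)) * (L / 2) powr (s - 1)"
    using sum_cylinder_length_Cons_ge[OF w, of N] by (intro mult_right_mono) (auto simp: L_def)
  also have "\<dots> = (\<Sum>a=1..N. cylinder_length (a # w) * (L / 2) powr (s - 1))"
    by (rule sum_distrib_right)
  also have "\<dots> \<le> (\<Sum>a=1..N. cylinder_length (a # w) powr s)"
  proof (rule sum_mono)
    fix a assume "a \<in> {1..N}"
    then have a: "1 \<le> a" by simp
    have pos: "0 < cylinder_length (a # w)" using w a by (intro cylinder_length_pos) auto
    have "(L / 2) powr (s - 1) \<le> cylinder_length (a # w) powr (s - 1)"
      using pos cylinder_length_Cons_le[OF w a] s by (intro powr_mono2') (auto simp: L_def)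
    then have "cylinder_length (a # w) * (L / 2) powr (s - 1)
        \<le> cylinder_length (a # w) * cylinder_length (a # w) powr (s - 1)"
      using pos by (intro mult_left_mono) auto
    also have "\<dots> = cylinder_length (a # w) powr s" using pos by (simp add: powr_diff)
    finally show "cylinder_length (a # w) * (L / 2) powr (s - 1) \<le> cylinder_length (a # w) powr s" .
  qed
  finally show ?thesis by (simp add: L_def)
qed

lemma finite_words: "finite (words N k)"
  unfolding words_def by (rule finite_lists_length_eq) simp

lemma words_0_notin: "w \<in> words N k \<Longrightarrow> 0 \<notin> set w"
  by (auto simp: words_def)

lemma sum_words_Suc: "sum h (words N (Suc k)) = (\<Sum>w\<in>words N k. \<Sum>a=1..N. h (a # w))"
proof -
  have "words N (Suc k) = (\<lambda>(w, a). a # w) ` (words N k \<times> {1..N})"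
    by (auto simp: words_def length_Suc_conv image_iff)
  then have "sum h (words N (Suc k)) = (\<Sum>(w, a)\<in>words N k \<times> {1..N}. h (a # w))"
    by (simp add: sum.reindex inj_on_def case_prod_unfold)
  also have "\<dots> = (\<Sum>w\<in>words N k. \<Sum>a=1..N. h (a # w))"
    by (rule sum.cartesian_product[symmetric])
  finally show ?thesis .
qed

lemma sum_words_cylinder_length_powr_ge:
  assumes "s < 1"
  shows "(2 powr (1 - s) * (1 - 2 / (real N + 2))) ^ k \<le> (\<Sum>w\<in>words N k. cylinder_length w powr s)"
proof (induction k)
  case 0
  have "words N 0 = {[]}" by (auto simp: words_def)
  then show ?case by (simp add: cylinder_length_def)
next
  case (Suc k)
  define q where "q = 2 powr (1 - s) * (1 - 2 / (real N + 2))"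
  have "0 \<le> q" by (simp add: q_def)
  then have "q ^ Suc k \<le> q * (\<Sum>w\<in>words N k. cylinder_length w powr s)"
    using Suc by (simp add: q_def mult_left_mono)
  also have "\<dots> = (\<Sum>w\<in>words N k. q * cylinder_length w powr s)" by (rule sum_distrib_left)
  also have "\<dots> \<le> (\<Sum>w\<in>words N k. \<Sum>a=1..N. cylinder_length (a # w) powr s)"
    unfolding q_def using assms
    by (intro sum_mono sum_cylinder_length_Cons_powr_ge) (auto dest: words_0_notin)
  also have "\<dots> = (\<Sum>w\<in>words N (Suc k). cylinder_length w powr s)" by (rule sum_words_Suc[symmetric])
  finally show ?case by (simp add: q_def)
qed

text \<open>
  The words of a suitable length \<open>k\<close> form the iterated function system described at the beginning.
  Its invariant set \<open>A\<close> is only invariant under blocks of \<open>k\<close> letters; adding the images of \<open>A\<close> under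
  all words gives a set that is invariant under the single branches.
\<close>

lemma bounded_type_set_hausdorff_dim_ge:
  assumes s: "0 < s" "s < 1"
  shows "\<exists>N. \<exists>S\<subseteq>{0<..<1}. (\<forall>x\<in>S. \<exists>a\<in>{1..N}. \<exists>y\<in>S. x = gauss_branch a y)
    \<and> ennreal s \<le> hausdorff_dim S"
proof -
  have "filterlim (\<lambda>N. 2 + real N) at_infinity sequentially"
    by (intro filterlim_at_top_imp_at_infinity filterlim_real_sequentially
        filterlim_tendsto_add_at_top[OF tendsto_const])
  then have "(\<lambda>N. 2 / (2 + real N)) \<longlonglongrightarrow> 0" by (intro tendsto_divide_0[OF tendsto_const])
  then have "(\<lambda>N. 2 powr (1 - s) * (1 - 2 / (real N + 2))) \<longlonglongrightarrow> 2 powr (1 - s) * (1 - 0)"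
    by (intro tendsto_intros) (simp add: add.commute)
  moreover have "1 < 2 powr (1 - s) * (1 - 0)" using s by simp
  ultimately have "\<forall>\<^sub>F N in sequentially. 1 < 2 powr (1 - s) * (1 - 2 / (real N + 2))"
    by (rule order_tendstoD(1))
  then have "\<forall>\<^sub>F N in sequentially. 1 < 2 powr (1 - s) * (1 - 2 / (real N + 2)) \<and> 1 \<le> N"
    using eventually_ge_at_top[of 1] by eventually_elim simp
  then obtain N :: nat where N: "1 < 2 powr (1 - s) * (1 - 2 / (real N + 2))" "1 \<le> N"
    by (auto simp: eventually_sequentially)
  define q where "q = 2 powr (1 - s) * (1 - 2 / (real N + 2))"
  have "1 < q" using N by (simp add: q_def)
  \<comment> \<open>The bound \<open>2\<close> pays for the distortion; \<open>k > 0\<close> makes the contraction ratios less than \<open>1\<close>.\<close>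
  obtain k where "2 < q ^ k" using real_arch_pow[OF \<open>1 < q\<close>] by blast
  then have k: "2 < q ^ k" "0 < k" by (auto intro: Nat.gr0I)
  define W where "W = words N k"
  define r where "r w = 1 / (denom w + denom' w)\<^sup>2" for w
  \<comment> \<open>On this interval the images of different branches are disjoint, while on \<open>[0,1]\<close> they share end points.\<close>
  define K where "K = {1 / (real N + 1) .. (real N + 1) / (real N + 2)}"
  have K01: "K \<subseteq> {0<..<1}"
  proof
    fix x assume "x \<in> K"
    then have x: "1 / (real N + 1) \<le> x" "x \<le> (real N + 1) / (real N + 2)" by (auto simp: K_def)
    have "0 < x" by (rule less_le_trans[OF _ x(1)]) simp
    moreover have "x < 1" by (rule le_less_trans[OF x(2)]) simp
    ultimately show "x \<in> {0<..<1}" by simp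
  qed
  have branchK: "gauss_branch a x \<in> K" if "a \<in> {1..N}" "x \<in> K" for a x
  proof -
    have x: "1 / (real N + 1) \<le> x" "0 < x" "x < 1" using that K01 by (auto simp: K_def)
    have a: "1 \<le> real a" "real a \<le> N" using that by auto
    have lo: "(real N + 2) / (real N + 1) = 1 + 1 / (real N + 1)" by (simp add: field_simps)
    have "1 / (real N + 1) \<le> 1 / (real a + x)" using x a by (intro frac_le) auto
    moreover have "1 / (real a + x) \<le> 1 / ((real N + 2) / (real N + 1))"
      unfolding lo using x a by (intro frac_le add_mono add_pos_pos) auto
    ultimately show ?thesis by (simp add: K_def gauss_branch_def)
  qed
  have letters: "0 \<notin> set w" "set w \<subseteq> {1..N}" "length w = k" if "w \<in> W" for w
    using that by (auto simp: W_def words_def)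
  have foldK: "fold gauss_branch w x \<in> K" if "set w \<subseteq> {1..N}" "x \<in> K" for w x
    using that
  proof (induction w arbitrary: x)
    case (Cons a w)
    then have "gauss_branch a x \<in> K" by (intro branchK) auto
    then show ?case using Cons by simp
  qed simp
  have cont: "continuous_on K (fold gauss_branch w)" if "set w \<subseteq> {1..N}" for w
    using that
  proof (induction w)
    case (Cons a w)
    have "real a + x \<noteq> 0" if "x \<in> K" for x
      using subsetD[OF K01 that] by (simp add: add_nonneg_eq_0_iff)
    then have "continuous_on K (gauss_branch a)"
      unfolding gauss_branch_def[abs_def] by (intro continuous_intros ballI)
    moreover have sub: "gauss_branch a ` K \<subseteq> K" using Cons.prems branchK by auto
    have "continuous_on K (fold gauss_branch w)" using Cons by simp
    from continuous_on_subset[OF this sub]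
    have "continuous_on (gauss_branch a ` K) (fold gauss_branch w)" .
    ultimately have "continuous_on K (fold gauss_branch w \<circ> gauss_branch a)"
      by (rule continuous_on_compose)
    then show ?case by (simp add: comp_def)
  qed (simp add: id_def)
  have "\<exists>A\<subseteq>K. (\<forall>x\<in>A. \<exists>w\<in>W. \<exists>y\<in>A. x = fold gauss_branch w y) \<and> ennreal s \<le> hausdorff_dim A"
  proof (rule ifs_hausdorff_dim_ge[where r = r])
    show "finite W" by (simp add: W_def finite_words)
    show "compact K" by (simp add: K_def)
    show "K \<noteq> {}" 
      using N(2) zero_le_mult_iff[of "real N" "real N"] by (simp add: K_def field_simps add_nonneg_nonneg add_increasing2)
    show "fold gauss_branch w x \<in> K" if "w \<in> W" "x \<in> K" for w x
      using foldK[OF letters(2)[OF that(1)] that(2)] .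
    show "continuous_on K (fold gauss_branch w)" if "w \<in> W" for w
      using cont[OF letters(2)[OF that]] .
    show "fold gauss_branch w ` K \<inter> fold gauss_branch v ` K = {}" if "w \<in> W" "v \<in> W" "w \<noteq> v" for w v
    proof (rule ccontr)
      assume "\<not> ?thesis"
      then obtain x y where "x \<in> K" "y \<in> K" "fold gauss_branch w x = fold gauss_branch v y" by blast
      then have "w = v" using letters[OF that(1)] letters[OF that(2)] K01
        by (intro word_map_inj[of w v x y]) auto
      then show False using that by simp
    qed
    show "0 < r w \<and> r w < 1" if wW: "w \<in> W" for w
    proof -
      obtain a v where w: "w = a # v" using letters(3)[OF wW] k by (cases w) auto
      then have "1 \<le> denom' w" using denom_bounds(1)[of v] letters(1)[OF wW] by simp
      then have "1 < denom w + denom' w" using denom_bounds(1)[OF letters(1)[OF wW]] by simp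
      then have "1 < (denom w + denom' w)\<^sup>2" "0 < denom w + denom' w" by (auto simp: one_less_power)
      then show ?thesis by (simp add: r_def)
    qed
    show "r w * dist x y \<le> dist (fold gauss_branch w x) (fold gauss_branch w y)"
      if "w \<in> W" "x \<in> K" "y \<in> K" for w x y
      using word_map_dist_ge[OF letters(1)[OF that(1)], of x y] subsetD[OF K01 that(2)] subsetD[OF K01 that(3)]
      by (simp add: r_def dist_real_def)
    show "0 < s" by fact
    have "2 \<le> (\<Sum>w\<in>W. cylinder_length w powr s)"
      using sum_words_cylinder_length_powr_ge[OF s(2), of N k] k by (simp add: W_def q_def)
    also have "\<dots> \<le> (\<Sum>w\<in>W. 2 * r w powr s)"
    proof (rule sum_mono)
      fix w assume w: "w \<in> W"
      have "cylinder_length w \<le> 2 * r w"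
        using cylinder_length_le[OF letters(1)[OF w]] by (simp add: r_def)
      then have "cylinder_length w powr s \<le> (2 * r w) powr s"
        using cylinder_length_pos[OF letters(1)[OF w]] s by (intro powr_mono2) auto
      also have "\<dots> = 2 powr s * r w powr s" by (rule powr_mult)
      also have "\<dots> \<le> 2 powr 1 * r w powr s" 
        using powr_mono[of s 1 2] s by (intro mult_right_mono) auto
      finally show "cylinder_length w powr s \<le> 2 * r w powr s" by simp
    qed
    also have "\<dots> = 2 * (\<Sum>w\<in>W. r w powr s)" by (rule sum_distrib_left[symmetric])
    finally show "1 \<le> (\<Sum>w\<in>W. r w powr s)" by simp
  qed
  then obtain A where A: "A \<subseteq> K" "\<forall>x\<in>A. \<exists>w\<in>W. \<exists>y\<in>A. x = fold gauss_branch w y"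
    "ennreal s \<le> hausdorff_dim A" by blast
  define S where "S = {fold gauss_branch u x |u x. set u \<subseteq> {1..N} \<and> x \<in> A}"
  have "S \<subseteq> {0<..<1}" 
  proof
    fix z assume "z \<in> S"
    then obtain u x where "z = fold gauss_branch u x" "set u \<subseteq> {1..N}" "x \<in> A"
      unfolding S_def by blast
    then have "z \<in> K" using foldK A(1) by blast
    then show "z \<in> {0<..<1}" using K01 by blast
  qed
  moreover have "\<exists>a\<in>{1..N}. \<exists>y\<in>S. z = gauss_branch a y" if z: "z \<in> S" for z
  proof -
    obtain u x where u: "z = fold gauss_branch u x" "set u \<subseteq> {1..N}" "x \<in> A"
      using z by (auto simp: S_def)
    have "\<exists>v y. z = fold gauss_branch v y \<and> set v \<subseteq> {1..N} \<and> y \<in> A \<and> v \<noteq> []"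
    proof (cases "u = []")
      case True
      obtain w y where "w \<in> W" "y \<in> A" "x = fold gauss_branch w y" using A(2) u(3) by blast
      then show ?thesis using u(1) True letters(2,3)[of w] k
        by (intro exI[of _ w] exI[of _ y]) auto
    qed (use u in blast)
    then obtain v a y where v: "z = fold gauss_branch (v @ [a]) y" "set (v @ [a]) \<subseteq> {1..N}" "y \<in> A"
      by (metis rev_exhaust)
    then have "fold gauss_branch v y \<in> S" by (auto simp: S_def)
    then show ?thesis using v by auto
  qed
  moreover have "A \<subseteq> S" unfolding S_def
    by (rule subsetI, rule CollectI, rule exI[of _ "[]"]) simp
  then have "ennreal s \<le> hausdorff_dim S" using A(3) hausdorff_dim_mono order_trans by blast
  ultimately show ?thesis by blast
qed

section \<open>Backward continued fractions\<close>

text \<open>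
  A backward digit \<open>2\<close> lowers the first regular partial quotient by one.
\<close>

lemma renyi_gauss_branch_ge_2:
  assumes "1 \<le> p" "0 < z" "z < 1"
  shows "\<lfloor>1 / (1 - gauss_branch (Suc p) z)\<rfloor> = 1"
    and "renyi (gauss_branch (Suc p) z) = gauss_branch p z"
proof -
  have p: "1 \<le> real p" using assms by simp
  then have eq: "1 / (1 - gauss_branch (Suc p) z) = 1 + gauss_branch p z"
    using assms by (simp add: gauss_branch_def field_simps)
  have "0 < gauss_branch p z \<and> gauss_branch p z < 1"
    using assms p by (simp add: gauss_branch_def)
  then show fl: "\<lfloor>1 / (1 - gauss_branch (Suc p) z)\<rfloor> = 1"
    unfolding eq by (intro floor_unique) auto
  show "renyi (gauss_branch (Suc p) z) = gauss_branch p z"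
    unfolding renyi_def fl unfolding eq by simp
qed

text \<open>
  Once the first partial quotient has been lowered to \<open>1\<close>, one backward digit removes it together
  with the next partial quotient \<open>q\<close>.
\<close>

lemma renyi_gauss_branch_1:
  assumes "1 \<le> q" "0 < y" "y < 1"
  shows "\<lfloor>1 / (1 - gauss_branch 1 (gauss_branch q y))\<rfloor> = int q + 1"
    and "renyi (gauss_branch 1 (gauss_branch q y)) = y"
proof -
  have q: "1 \<le> real q" using assms by simp
  then have eq: "1 / (1 - gauss_branch 1 (gauss_branch q y)) = 1 + real q + y"
    using assms by (simp add: gauss_branch_def field_simps)
  show fl: "\<lfloor>1 / (1 - gauss_branch 1 (gauss_branch q y))\<rfloor> = int q + 1"
    unfolding eq using assms by (intro floor_unique) auto
  show "renyi (gauss_branch 1 (gauss_branch q y)) = y"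
    unfolding renyi_def fl unfolding eq by simp
qed

text \<open>
  The orbit under the Renyi map may leave \<open>S\<close> while the first partial quotient is being lowered.  It
  stays in the set \<open>T\<close> of points whose first partial quotient is replaced by any number up to \<open>N\<close>.
\<close>

lemma bounded_type_subset_bcf_bounded:
  assumes S01: "S \<subseteq> {0<..<1}"
    and S: "\<And>x. x \<in> S \<Longrightarrow> \<exists>a\<in>{1..N}. \<exists>y\<in>S. x = gauss_branch a y"
    and n: "N + 2 \<le> n"
  shows "S \<subseteq> bcf_bounded n"
proof -
  define T where "T = {gauss_branch a z |a z. a \<in> {1..N} \<and> z \<in> S}"
  have "S \<subseteq> T" using S unfolding T_def by blast
  have step: "renyi x \<in> T \<and> \<lfloor>1 / (1 - x)\<rfloor> + 1 \<le> int n" if x: "x \<in> T" for x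
  proof -
    obtain a z where a: "x = gauss_branch a z" "a \<in> {1..N}" "z \<in> S" using x by (auto simp: T_def)
    have z: "0 < z" "z < 1" using a S01 by auto
    show ?thesis
    proof (cases "a = 1")
      case True
      obtain q y where q: "z = gauss_branch q y" "q \<in> {1..N}" "y \<in> S" using S a(3) by blast
      have y: "0 < y" "y < 1" using q S01 by auto
      have "1 \<le> q" using q by simp
      note r = renyi_gauss_branch_1[OF this y]
      have "x = gauss_branch 1 (gauss_branch q y)" using a True q by simp
      then show ?thesis using r q \<open>S \<subseteq> T\<close> n by auto
    next
      case False
      then obtain p where p: "a = Suc p" "1 \<le> p" using a(2) by (cases a) auto
      have "gauss_branch p z \<in> T" 
        unfolding T_def using p a by (intro CollectI exI[of _ p] exI[of _ z]) auto
      then show ?thesis using renyi_gauss_branch_ge_2[OF p(2) z] a(1) p(1) n by simp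
    qed
  qed
  show ?thesis
  proof
    fix x assume x: "x \<in> S"
    have "(renyi ^^ j) x \<in> T" for j
      by (induction j) (use x \<open>S \<subseteq> T\<close> step in auto)
    then have "bcf_digit j x \<le> int n" for j unfolding bcf_digit_def using step by blast
    then show "x \<in> bcf_bounded n" using x S01 by (auto simp: bcf_bounded_def)
  qed
qed

theorem proposition1p3:
  shows "(\<lambda>n. hausdorff_dim (bcf_bounded n)) \<longlonglongrightarrow> 1"
proof (rule order_tendstoI)
  fix a :: ennreal assume "a < 1"
  then obtain b where b: "a < b" "b < 1" using dense by blast
  then obtain s where s: "b = ennreal s" "0 \<le> s" by (cases b) auto
  have "0 < b" using b(1) by (rule le_less_trans[rotated]) simp
  then have "0 < s" "s < 1" using b s by (auto simp: ennreal_less_iff simp flip: ennreal_1)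
  then obtain N S where NS: "S \<subseteq> {0<..<1}" "\<forall>x\<in>S. \<exists>a\<in>{1..N}. \<exists>y\<in>S. x = gauss_branch a y"
    "ennreal s \<le> hausdorff_dim S" using bounded_type_set_hausdorff_dim_ge[of s] by blast
  have "\<forall>\<^sub>F n in sequentially. N + 2 \<le> n" by (rule eventually_ge_at_top)
  then show "\<forall>\<^sub>F n in sequentially. a < hausdorff_dim (bcf_bounded n)"
  proof eventually_elim
    case (elim n)
    have "S \<subseteq> bcf_bounded n" using NS elim by (intro bounded_type_subset_bcf_bounded[of S N n]) auto
    then have "ennreal s \<le> hausdorff_dim (bcf_bounded n)"
      using NS(3) hausdorff_dim_mono order_trans by blast
    then show ?case using b s by auto
  qed
next
  fix a :: ennreal assume "1 < a"
  have "hausdorff_dim (bcf_bounded n) \<le> 1" for n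
  proof -
    have "bcf_bounded n \<subseteq> {0..1}" by (auto simp: bcf_bounded_def)
    then show ?thesis using hausdorff_dim_mono hausdorff_dim_unit_interval_le order_trans by blast
  qed
  then show "\<forall>\<^sub>F n in sequentially. hausdorff_dim (bcf_bounded n) < a"
    using \<open>1 < a\<close> by (intro always_eventually allI) (rule le_less_trans)
qed

end
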